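(* Let $0<a<1$ and put $\rho=(\rho_1,\rho_2,\rho_3)=(-a,0,a)$ and, for $i=1,2,3$, $$z_i=\frac{2\rho_i}{1+\rho_i^2},\qquad u_i=\frac{\rho_i+\mathrm i}{\sqrt2},\qquad v_i=\frac{\rho_i-\mathrm i}{\sqrt2},$$ where $\mathrm i$ is the imaginary unit. If $L$ is a Hermitian $3\times3$ complex matrix with $$(1-\bar u_iu_j)_{ij}\circ L\succeq0,\qquad (1-\bar v_iv_j)_{ij}\circ L\succeq0,$$ then $$(2-\bar z_iz_j)_{ij}\circ L\succeq0 .$$ (Thus the identity disk multiplier has norm at most $\sqrt2$ on the complete right-angle admissible-kernel cone over these nodes.)
   Context: $\circ$ denotes the entrywise (Schur/Hadamard) product of matrices, and $\succeq0$ means positive semidefinite. The admissible-kernel cone is the set of Hermitian $L$ satisfying the two displayed hypotheses, and "the identity multiplier has norm at most $\sqrt2$" on it means that $(2-\bar z_iz_j)_{ij}\circ L\succeq0$ for all $L$ in it. *)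

theory Defs
  imports "HOL-Analysis.Analysis"
begin

definition hermitian_matrix :: "complex ^ 'n ^ 'n \<Rightarrow> bool" where
  "hermitian_matrix A \<longleftrightarrow> (\<forall>i j. A $ j $ i = cnj (A $ i $ j))"

text \<open>
  The quadratic form of a Hermitian matrix takes real values, so that taking the real part
  below discards nothing.
\<close>

definition psd_matrix :: "complex ^ 'n ^ 'n \<Rightarrow> bool" where
  "psd_matrix A \<longleftrightarrow> hermitian_matrix A \<and>
     (\<forall>x :: complex ^ 'n. 0 \<le> Re (\<Sum>i\<in>UNIV. \<Sum>j\<in>UNIV. cnj (x $ i) * A $ i $ j * x $ j))"

text \<open>
  The library operation \<open>*\<close> on \<open>vec\<close> acts componentwise. On matrices, which are vectors of
  rows, it is therefore the Schur product; the matrix product is \<open>**\<close>.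
\<close>

abbreviation schur_product :: "complex ^ 'n ^ 'n \<Rightarrow> complex ^ 'n ^ 'n \<Rightarrow> complex ^ 'n ^ 'n"
    (infixl "\<odot>" 70) where
  "A \<odot> B \<equiv> A * B"

lemma schur_product_nth: "(A \<odot> B) $ i $ j = A $ i $ j * B $ i $ j"
  by simp

end

theory Submission
  imports Defs
begin

text \<open>
  Write \<open>F\<^sub>u\<close>, \<open>F\<^sub>v\<close> for the matrices \<open>1 - cnj (u\<^sub>i) * u\<^sub>j\<close> and \<open>1 - cnj (v\<^sub>i) * v\<^sub>j\<close>. The
  theorem follows from an explicit decomposition of the multiplier (\<open>multiplier_decomposition\<close>).
  With \<open>x = \<rho>\<^sub>i\<close> and \<open>y = \<rho>\<^sub>j\<close>, the entry \<open>2 - 4 x y / ((1 + x\<^sup>2) (1 + y\<^sup>2))\<close> equals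

    \<open>2 cnj (f x) f y (F\<^sub>u)\<^sub>i\<^sub>j + 2 f x cnj (f y) (F\<^sub>v)\<^sub>i\<^sub>j + 4 g x g y\<close>,

  where \<open>f t = (1 - \<i> t) / (1 + t\<^sup>2)\<close> and \<open>g t = t\<^sup>2 / (1 + t\<^sup>2)\<close>. After multiplying entrywise
  by \<open>L\<close>, the first two summands are diagonal congruences of the two matrices that are positive
  semidefinite by hypothesis, and the last is a diagonal congruence of \<open>L\<close> itself. So it remains
  to see that \<open>L\<close> is positive semidefinite. As \<open>\<bar>\<rho>\<^sub>i\<bar> < 1\<close> makes the modulus of \<open>u\<^sub>i\<close> less than
  \<open>1\<close>, the matrix \<open>L\<close> is the Schur product of \<open>F\<^sub>u \<odot> L\<close> with the Szego kernel
  \<open>1 / (1 - cnj (u\<^sub>i) * u\<^sub>j)\<close>; expanding the kernel into a geometric series exhibits the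
  quadratic form of \<open>L\<close> as a convergent series of values of the quadratic form of \<open>F\<^sub>u \<odot> L\<close>
  (\<open>psd_matrix_divide_szego\<close>).

  The decomposition comes from looking for positive semidefinite \<open>P\<close>, \<open>Q\<close> that write the
  multiplier as \<open>P \<odot> F\<^sub>u + Q \<odot> F\<^sub>v\<close>. Transposing \<open>L\<close> exchanges the two hypotheses, so \<open>Q\<close> may be
  taken as the entrywise conjugate of \<open>P\<close>. Up to the factors \<open>1 + \<rho>\<^sub>i\<^sup>2\<close>, giving the entries of
  \<open>P\<close> against the node \<open>0\<close> the least possible modulus suggests the rank-one part
  \<open>(1 + \<i> x) (1 - \<i> y)\<close>. What is left is \<open>2 x\<^sup>2 y\<^sup>2 / (1 - x y)\<close>, the same in \<open>P\<close> and \<open>Q\<close>, and its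
  denominator cancels because \<open>F\<^sub>u + F\<^sub>v\<close> has the entries \<open>1 - x y\<close>.
\<close>

lemma psd_matrix_add:
  assumes "psd_matrix A" and "psd_matrix B"
  shows "psd_matrix (A + B)"
  unfolding psd_matrix_def hermitian_matrix_def
proof (intro conjI allI)
  fix i j
  have "A $ j $ i = cnj (A $ i $ j)" "B $ j $ i = cnj (B $ i $ j)"
    using assms unfolding psd_matrix_def hermitian_matrix_def by blast+
  then show "(A + B) $ j $ i = cnj ((A + B) $ i $ j)"
    by simp
next
  fix x
  have "0 \<le> Re (\<Sum>i\<in>UNIV. \<Sum>j\<in>UNIV. cnj (x $ i) * A $ i $ j * x $ j)
      + Re (\<Sum>i\<in>UNIV. \<Sum>j\<in>UNIV. cnj (x $ i) * B $ i $ j * x $ j)"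
    using assms unfolding psd_matrix_def by (intro add_nonneg_nonneg) blast+
  also have "\<dots> = Re (\<Sum>i\<in>UNIV. \<Sum>j\<in>UNIV. cnj (x $ i) * (A + B) $ i $ j * x $ j)"
    by (simp add: ring_distribs sum.distrib)
  finally show "0 \<le> Re (\<Sum>i\<in>UNIV. \<Sum>j\<in>UNIV. cnj (x $ i) * (A + B) $ i $ j * x $ j)" .
qed

lemma psd_matrix_diagonal_congruence:
  assumes "psd_matrix A"
  shows "psd_matrix (\<chi> i j. cnj (d i) * A $ i $ j * d j)"
  unfolding psd_matrix_def hermitian_matrix_def
proof (intro conjI allI)
  fix i j
  have "A $ j $ i = cnj (A $ i $ j)"
    using assms unfolding psd_matrix_def hermitian_matrix_def by blast
  then show "(\<chi> i j. cnj (d i) * A $ i $ j * d j) $ j $ i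
      = cnj ((\<chi> i j. cnj (d i) * A $ i $ j * d j) $ i $ j)"
    by simp
next
  fix x
  have "0 \<le> Re (\<Sum>i\<in>UNIV. \<Sum>j\<in>UNIV.
      cnj ((\<chi> i. d i * x $ i) $ i) * A $ i $ j * (\<chi> i. d i * x $ i) $ j)"
    using assms unfolding psd_matrix_def by blast
  then show "0 \<le> Re (\<Sum>i\<in>UNIV. \<Sum>j\<in>UNIV.
      cnj (x $ i) * (\<chi> i j. cnj (d i) * A $ i $ j * d j) $ i $ j * x $ j)"
    by (simp add: mult_ac)
qed

lemma norm_cnj_mult_less_1:
  fixes w z :: complex
  assumes "norm w < 1" and "norm z < 1"
  shows "norm (cnj w * z) < 1"
  using mult_strict_mono'[OF assms] by (simp add: norm_mult)

text \<open>
  Since \<open>1 / (1 - cnj (w\<^sub>i) * w\<^sub>j)\<close> is the sum over \<open>k\<close> of \<open>cnj (w\<^sub>i ^ k) * w\<^sub>j ^ k\<close>, dividing by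
  the Szego denominator adds up the diagonal congruences by the powers \<open>w ^ k\<close>.
\<close>

lemma psd_matrix_divide_szego:
  fixes A :: "complex ^ 'n ^ 'n" and w :: "'n \<Rightarrow> complex"
  assumes psd: "psd_matrix A" and w: "\<And>i. norm (w i) < 1"
  shows "psd_matrix (\<chi> i j. A $ i $ j / (1 - cnj (w i) * w j))"
  unfolding psd_matrix_def hermitian_matrix_def
proof (intro conjI allI)
  fix i j
  have "A $ j $ i = cnj (A $ i $ j)"
    using psd unfolding psd_matrix_def hermitian_matrix_def by blast
  then show "(\<chi> i j. A $ i $ j / (1 - cnj (w i) * w j)) $ j $ i
      = cnj ((\<chi> i j. A $ i $ j / (1 - cnj (w i) * w j)) $ i $ j)"
    by (simp add: mult.commute)
next
  fix x :: "complex ^ 'n"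
  define q where "q k = (\<Sum>i\<in>UNIV. \<Sum>j\<in>UNIV.
      cnj (x $ i) * (cnj (w i ^ k) * A $ i $ j * w j ^ k) * x $ j)" for k
  have nonneg: "0 \<le> Re (q k)" for k
    using psd_matrix_diagonal_congruence[OF psd, of "\<lambda>i. w i ^ k"]
    unfolding psd_matrix_def q_def vec_lambda_beta by blast
  have entry: "(\<lambda>k. cnj (x $ i) * (cnj (w i ^ k) * A $ i $ j * w j ^ k) * x $ j)
      sums (cnj (x $ i) * (A $ i $ j / (1 - cnj (w i) * w j)) * x $ j)" for i j
    using sums_mult[OF geometric_sums[OF norm_cnj_mult_less_1[OF w w]],
        of "cnj (x $ i) * A $ i $ j * x $ j"]
    by (simp add: power_mult_distrib mult_ac)
  have "q sums (\<Sum>i\<in>UNIV. \<Sum>j\<in>UNIV.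
      cnj (x $ i) * (A $ i $ j / (1 - cnj (w i) * w j)) * x $ j)"
    unfolding q_def by (intro sums_sum entry)
  from sums_le[OF nonneg sums_zero sums_Re[OF this]]
  show "0 \<le> Re (\<Sum>i\<in>UNIV. \<Sum>j\<in>UNIV.
      cnj (x $ i) * (\<chi> i j. A $ i $ j / (1 - cnj (w i) * w j)) $ i $ j * x $ j)"
    by simp
qed

lemma psd_matrix_of_szego_schur_product:
  fixes L :: "complex ^ 'n ^ 'n" and w :: "complex ^ 'n"
  assumes psd: "psd_matrix ((\<chi> i j. 1 - cnj (w $ i) * w $ j) \<odot> L)"
    and w: "\<And>i. norm (w $ i) < 1"
  shows "psd_matrix L"
proof -
  have "1 - cnj (w $ i) * w $ j \<noteq> 0" for i j
    using norm_cnj_mult_less_1[OF w w, of i j] by auto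
  then have "(\<chi> i j. ((\<chi> i j. 1 - cnj (w $ i) * w $ j) \<odot> L) $ i $ j
      / (1 - cnj (w $ i) * w $ j)) = L"
    by (simp add: vec_eq_iff)
  with psd_matrix_divide_szego[OF psd, of "\<lambda>i. w $ i"] w show ?thesis by metis
qed

text \<open>
  As \<open>2 (1 - cnj (U x) * U y) = 1 - x y - \<i> (x - y)\<close>, and the factor with \<open>V\<close> is its conjugate,
  clearing the denominators \<open>1 + x\<^sup>2\<close> and \<open>1 + y\<^sup>2\<close> turns the claim into
  \<open>(1 + x\<^sup>2) (1 + y\<^sup>2) - 2 x y = Re ((1 + \<i> x) (1 - \<i> y) (1 - x y - \<i> (x - y))) + 2 x\<^sup>2 y\<^sup>2\<close>.
\<close>

lemma multiplier_decomposition: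
  fixes x y :: real
  defines "f \<equiv> \<lambda>t. (1 - \<i> * complex_of_real t) / complex_of_real (1 + t\<^sup>2)"
    and "g \<equiv> \<lambda>t. complex_of_real (t\<^sup>2 / (1 + t\<^sup>2))"
    and "U \<equiv> \<lambda>t. (complex_of_real t + \<i>) / complex_of_real (sqrt 2)"
    and "V \<equiv> \<lambda>t. (complex_of_real t - \<i>) / complex_of_real (sqrt 2)"
    and "Z \<equiv> \<lambda>t. complex_of_real (2 * t / (1 + t\<^sup>2))"
  shows "2 - cnj (Z x) * Z y
    = 2 * (cnj (f x) * (1 - cnj (U x) * U y) * f y)
      + 2 * (f x * (1 - cnj (V x) * V y) * cnj (f y)) + 4 * (g x * g y)"
proof -
  define X Y where "X = complex_of_real x" and "Y = complex_of_real y"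
  have cnj_XY: "cnj X = X" "cnj Y = Y"
    unfolding X_def Y_def by simp_all
  have sqrt2: "complex_of_real (sqrt 2) * complex_of_real (sqrt 2) = 2"
    by (simp flip: of_real_mult)
  have UU: "1 - cnj (U x) * U y = (1 - X * Y - \<i> * (X - Y)) / 2"
    unfolding U_def X_def Y_def
    by (simp add: sqrt2) (simp add: field_simps)
  have VV: "1 - cnj (V x) * V y = (1 - X * Y + \<i> * (X - Y)) / 2"
    unfolding V_def X_def Y_def
    by (simp add: sqrt2) (simp add: field_simps)
  have nz: "1 + X\<^sup>2 \<noteq> 0" "1 + Y\<^sup>2 \<noteq> 0"
  proof -
    have "1 + t\<^sup>2 \<noteq> 0" for t :: real
      by (smt (verit) zero_le_power2)
    then have "complex_of_real (1 + t\<^sup>2) \<noteq> 0" for t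
      by (metis of_real_eq_0_iff)
    then show "1 + X\<^sup>2 \<noteq> 0" "1 + Y\<^sup>2 \<noteq> 0"
      unfolding X_def Y_def by simp_all
  qed
  have numerators: "2 * ((1 + X\<^sup>2) * (1 + Y\<^sup>2)) - 4 * X * Y
    = (1 + \<i> * X) * (1 - X * Y - \<i> * (X - Y)) * (1 - \<i> * Y)
      + (1 - \<i> * X) * (1 - X * Y + \<i> * (X - Y)) * (1 + \<i> * Y) + 4 * (X\<^sup>2 * Y\<^sup>2)"
    unfolding X_def Y_def by (simp add: complex_eq_iff power2_eq_square algebra_simps)
  have f_values: "f x = (1 - \<i> * X) / (1 + X\<^sup>2)" "cnj (f x) = (1 + \<i> * X) / (1 + X\<^sup>2)"
    "f y = (1 - \<i> * Y) / (1 + Y\<^sup>2)" "cnj (f y) = (1 + \<i> * Y) / (1 + Y\<^sup>2)"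
    unfolding f_def X_def Y_def by simp_all
  have g_values: "g x = X\<^sup>2 / (1 + X\<^sup>2)" "g y = Y\<^sup>2 / (1 + Y\<^sup>2)"
    unfolding g_def X_def Y_def by simp_all
  have split_quotient: "(p * q * r + p' * q' * r' + 4 * (s * t)) / (M * N)
      = 2 * (p / M * (q / 2) * (r / N)) + 2 * (p' / M * (q' / 2) * (r' / N)) + 4 * (s / M * (t / N))"
    for p q r p' q' r' s t M N :: complex
    by (simp add: add_divide_distrib mult.assoc)
  have "2 - cnj (Z x) * Z y
      = (2 * ((1 + X\<^sup>2) * (1 + Y\<^sup>2)) - 4 * X * Y) / ((1 + X\<^sup>2) * (1 + Y\<^sup>2))"
    using nz unfolding Z_def by (simp flip: X_def Y_def add: cnj_XY diff_divide_distrib)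
  also have "\<dots> = 2 * (cnj (f x) * (1 - cnj (U x) * U y) * f y)
      + 2 * (f x * (1 - cnj (V x) * V y) * cnj (f y)) + 4 * (g x * g y)"
    unfolding numerators UU VV f_values(2,4) unfolding f_values(1,3) g_values
    by (rule split_quotient)
  finally show ?thesis .
qed

theorem theorem8p1:
  fixes a :: real and \<rho> :: "real ^ 3" and z u v :: "complex ^ 3" and L :: "complex ^ 3 ^ 3"
  assumes "0 < a" and "a < 1"
    and "\<rho> = vector [- a, 0, a]"
    and "z = (\<chi> i. complex_of_real (2 * \<rho> $ i / (1 + (\<rho> $ i)\<^sup>2)))"
    and "u = (\<chi> i. (complex_of_real (\<rho> $ i) + \<i>) / complex_of_real (sqrt 2))"
    and "v = (\<chi> i. (complex_of_real (\<rho> $ i) - \<i>) / complex_of_real (sqrt 2))"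
    and "hermitian_matrix L"
    and "psd_matrix ((\<chi> i j. 1 - cnj (u $ i) * u $ j) \<odot> L)"
    and "psd_matrix ((\<chi> i j. 1 - cnj (v $ i) * v $ j) \<odot> L)"
  shows "psd_matrix ((\<chi> i j. 2 - cnj (z $ i) * z $ j) \<odot> L)"
proof -
  have nodes: "\<bar>\<rho> $ i\<bar> < 1" for i
    using exhaust_3[of i] assms(1-3) by (auto simp: vector_3)
  have u_disk: "norm (u $ i) < 1" for i
  proof -
    have "(\<rho> $ i)\<^sup>2 < 1"
      using nodes[of i] by (simp add: abs_square_less_1)
    then have "(norm (u $ i))\<^sup>2 < 1"
      unfolding assms(5) by (simp add: norm_divide power_divide cmod_power2)
    then show ?thesis
      by (simp add: power_less_one_iff abs_square_less_1)
  qed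
  have L_psd: "psd_matrix L"
    by (rule psd_matrix_of_szego_schur_product[OF assms(8) u_disk])
  define f where "f i = (1 - \<i> * complex_of_real (\<rho> $ i)) / complex_of_real (1 + (\<rho> $ i)\<^sup>2)" for i
  define g where "g i = complex_of_real ((\<rho> $ i)\<^sup>2 / (1 + (\<rho> $ i)\<^sup>2))" for i
  define A where "A = (\<chi> i j. cnj (f i) * ((\<chi> i j. 1 - cnj (u $ i) * u $ j) \<odot> L) $ i $ j * f j)"
  define B where "B = (\<chi> i j. cnj (cnj (f i)) * ((\<chi> i j. 1 - cnj (v $ i) * v $ j) \<odot> L) $ i $ j
      * cnj (f j))"
  define C where "C = (\<chi> i j. cnj (g i) * L $ i $ j * g j)"
  have "psd_matrix A" "psd_matrix B" "psd_matrix C"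
    unfolding A_def B_def C_def
    using psd_matrix_diagonal_congruence[OF assms(8), of f]
      psd_matrix_diagonal_congruence[OF assms(9), of "\<lambda>i. cnj (f i)"]
      psd_matrix_diagonal_congruence[OF L_psd, of g]
    by blast+
  \<comment> \<open>The coefficients \<open>2\<close>, \<open>2\<close>, \<open>4\<close> of the decomposition arise by repeated addition.\<close>
  then have "psd_matrix (A + B + C + C)"
    by (intro psd_matrix_add)
  then have sum_psd: "psd_matrix ((A + B + C + C) + (A + B + C + C))"
    by (rule psd_matrix_add[OF _ \<open>psd_matrix (A + B + C + C)\<close>])
  have "(2 - cnj (z $ i) * z $ j) * L $ i $ j
      = ((A + B + C + C) + (A + B + C + C)) $ i $ j" for i j
  proof -
    have multiplier: "2 - cnj (z $ i) * z $ j
      = 2 * (cnj (f i) * (1 - cnj (u $ i) * u $ j) * f j)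
        + 2 * (f i * (1 - cnj (v $ i) * v $ j) * cnj (f j)) + 4 * (g i * g j)"
      unfolding assms(4,5,6) f_def g_def
      using multiplier_decomposition[of "\<rho> $ i" "\<rho> $ j"] by (simp only: vec_lambda_beta)
    have "cnj (g i) = g i"
      by (simp add: g_def)
    then show ?thesis
      unfolding A_def B_def C_def multiplier
      by (simp add: algebra_simps)
  qed
  then have "(\<chi> i j. 2 - cnj (z $ i) * z $ j) \<odot> L
      = (A + B + C + C) + (A + B + C + C)"
    unfolding vec_eq_iff schur_product_nth by simp
  with sum_psd show ?thesis
    by simp
qed

end
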